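(* Let $Q=[q_{ij}]$ be a real symmetric $n\times n$ matrix and let $f(x)=x^\top Qx$ for $x\in\mathbb{Z}^n$. Then $f$ is DDM-convex if and only if $Q$ is diagonally dominant with nonnegative diagonals, i.e. $$q_{ii}\ge\sum_{j:\,j\ne i}|q_{ij}|\qquad\text{for all } i=1,\dots,n.$$
   Context: For $x,y\in\mathbb{Z}^n$, the vector $\mu(x,y)\in\mathbb{Z}^n$ is defined componentwise by $\mu(x,y)_i=\lceil (x_i+y_i)/2\rceil$ if $x_i\ge y_i$, and $\mu(x,y)_i=\lfloor (x_i+y_i)/2\rfloor$ if $x_i<y_i$. A function $f:\mathbb{Z}^n\to\mathbb{R}\cup\{+\infty\}$ is called DDM-convex if $f(x)+f(y)\ge f(\mu(x,y))+f(\mu(y,x))$ for all $x,y\in\mathbb{Z}^n$. *)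

theory Defs
  imports "HOL-Analysis.Analysis"
begin

definition ddm_mid :: "int ^ 'n \<Rightarrow> int ^ 'n \<Rightarrow> int ^ 'n" where
  "ddm_mid x y = (\<chi> i. if x $ i \<ge> y $ i
     then \<lceil>real_of_int (x $ i + y $ i) / 2\<rceil>
     else \<lfloor>real_of_int (x $ i + y $ i) / 2\<rfloor>)"

(* The codomain of the real numbers extended by +\<infinity> alone is rendered as ereal with the value
   -\<infinity> excluded. *)
definition ddm_convex :: "(int ^ 'n \<Rightarrow> ereal) \<Rightarrow> bool" where
  "ddm_convex f \<longleftrightarrow> (\<forall>x. f x \<noteq> -\<infinity>) \<and>
     (\<forall>x y. f x + f y \<ge> f (ddm_mid x y) + f (ddm_mid y x))"

definition real_vec :: "int ^ 'n \<Rightarrow> real ^ 'n" where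
  "real_vec x = (\<chi> i. real_of_int (x $ i))"

definition quad_form :: "real ^ 'n ^ 'n \<Rightarrow> int ^ 'n \<Rightarrow> real" where
  "quad_form Q x = real_vec x \<bullet> (Q *v real_vec x)"

end

theory Submission
  imports Defs
begin

text \<open>
  The sum of \<open>\<mu>(x,y)\<close> and \<open>\<mu>(y,x)\<close> is \<open>x + y\<close>, and their difference depends on \<open>d = x - y\<close> alone:
  it is \<open>\<pi>(d)\<close>, which replaces the even entries of \<open>d\<close> by 0 and the odd ones by their signs.
  As \<open>2 f(x) + 2 f(y) = f(x + y) + f(x - y)\<close> for a quadratic form, DDM-convexity
  amounts to \<open>f(\<pi>(d)) \<le> f(d)\<close> for every integer vector \<open>d\<close> (lemma
  \<open>ddm_convex_quad_form_iff\<close>).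

  With \<open>e = \<pi>(d)\<close> and \<open>D i j = d i * d j - e i * e j\<close> we have
  \<open>f(d) - f(e) = (\<Sum>i j. q i j * D i j)\<close>. The integers satisfy \<open>2 \<bar>D i j\<bar> \<le> D i i + D j j\<close>,
  so by the symmetry of \<open>Q\<close> the off-diagonal terms of row \<open>i\<close> cost at most
  \<open>D i i * (\<Sum>j\<noteq>i. \<bar>q i j\<bar>)\<close>, and diagonal dominance pays for them.

  Conversely, fix \<open>i\<close> and let \<open>d\<close> have the entry 2 at \<open>i\<close> and elsewhere the entries \<open>\<plusminus>1\<close>, with
  sign opposite to that of \<open>q i j\<close>. Passing to \<open>\<pi>(d)\<close> changes only the entry at \<open>i\<close>, to 0, and
  \<open>f(d) - f(\<pi>(d)) = 4 (q i i - (\<Sum>j\<noteq>i. \<bar>q i j\<bar>))\<close>.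
\<close>

definition odd_sgn :: "int \<Rightarrow> int" where
  "odd_sgn a = (if even a then 0 else sgn a)"

definition odd_sgn_vec :: "int ^ 'n \<Rightarrow> int ^ 'n" where
  "odd_sgn_vec d = (\<chi> i. odd_sgn (d $ i))"

lemma ddm_mid_nth:
  "ddm_mid x y $ i = (if x $ i \<ge> y $ i then - ((- (x $ i + y $ i)) div 2) else (x $ i + y $ i) div 2)"
proof -
  have "\<lfloor>real_of_int s / 2\<rfloor> = s div 2" for s
    using floor_divide_of_int_eq[of s 2] by simp
  moreover have "\<lceil>real_of_int s / 2\<rceil> = - ((- s) div 2)" for s
    using ceiling_divide_eq_div[of s 2] by simp
  ultimately show ?thesis by (simp only: ddm_mid_def vec_lambda_beta)
qed

lemma ddm_mid_add: "ddm_mid x y + ddm_mid y x = x + y"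
proof -
  have "ddm_mid x y $ i + ddm_mid y x $ i = x $ i + y $ i" for i
    unfolding ddm_mid_nth by (auto simp: add.commute)
  then show ?thesis by (simp add: vec_eq_iff)
qed

lemma ddm_mid_diff: "ddm_mid x y - ddm_mid y x = odd_sgn_vec (x - y)"
proof -
  have "ddm_mid x y $ i - ddm_mid y x $ i = odd_sgn (x $ i - y $ i)" for i
    unfolding ddm_mid_nth odd_sgn_def sgn_if
    by (cases "x $ i" "y $ i" rule: linorder_cases; cases "even (x $ i - y $ i)";
        (simp add: add.commute; presburger)?)
  then show ?thesis by (simp add: vec_eq_iff odd_sgn_vec_def)
qed

lemma quad_form_eq_sum:
  "quad_form Q x = (\<Sum>i\<in>UNIV. \<Sum>j\<in>UNIV. Q $ i $ j * real_of_int (x $ i * x $ j))"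
  by (simp add: quad_form_def real_vec_def inner_vec_def matrix_vector_mult_def
      sum_distrib_left mult_ac)

lemma quad_form_parallelogram:
  "2 * quad_form Q x + 2 * quad_form Q y = quad_form Q (x + y) + quad_form Q (x - y)"
  unfolding quad_form_eq_sum sum_distrib_left sum.distrib[symmetric]
  by (intro sum.cong refl) (simp add: algebra_simps)

text \<open>
  Both \<open>(x, y)\<close> and \<open>(\<mu>(x,y), \<mu>(y,x))\<close> have the sum \<open>x + y\<close>, so the parallelogram law leaves only
  the values of the form at the two differences to compare.
\<close>

lemma ddm_convex_quad_form_iff:
  "ddm_convex (\<lambda>x. ereal (quad_form Q x)) \<longleftrightarrow>
    (\<forall>d. quad_form Q (odd_sgn_vec d) \<le> quad_form Q d)"
proof -
  have "quad_form Q (ddm_mid x y) + quad_form Q (ddm_mid y x) \<le> quad_form Q x + quad_form Q y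
      \<longleftrightarrow> quad_form Q (odd_sgn_vec (x - y)) \<le> quad_form Q (x - y)" for x y
    using quad_form_parallelogram[of Q x y]
      quad_form_parallelogram[of Q "ddm_mid x y" "ddm_mid y x"]
    unfolding ddm_mid_add ddm_mid_diff by linarith
  then have "ddm_convex (\<lambda>x. ereal (quad_form Q x)) \<longleftrightarrow>
      (\<forall>x y. quad_form Q (odd_sgn_vec (x - y)) \<le> quad_form Q (x - y))"
    by (simp add: ddm_convex_def)
  also have "\<dots> \<longleftrightarrow> (\<forall>d. quad_form Q (odd_sgn_vec d) \<le> quad_form Q d)"
    by (intro iffI allI) (metis diff_0_right, blast)
  finally show ?thesis .
qed

text \<open>
  If \<open>odd_sgn\<close> sends \<open>a + b\<close> to a sum of modulus 2, then \<open>a\<close> and \<open>b\<close> are odd of the same sign, so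
  \<open>\<bar>a + b\<bar> \<ge> 2\<close>; a sum of modulus 1 arises only from an odd, hence nonzero, \<open>a + b\<close>.
\<close>

lemma abs_odd_sgn_add_le: "\<bar>odd_sgn a + odd_sgn b\<bar> \<le> \<bar>a + b\<bar>"
  unfolding odd_sgn_def sgn_if by (smt (verit) even_add)

lemma odd_sgn_minus: "odd_sgn (- a) = - odd_sgn a"
  by (simp add: odd_sgn_def sgn_minus)

text \<open>
  For \<open>s = 1\<close> and \<open>s = -1\<close>, the inequality \<open>(odd_sgn a + s * odd_sgn b)\<^sup>2 \<le> (a + s * b)\<^sup>2\<close>
  expands to one of the two signs of the claim.
\<close>

lemma abs_mult_diff_odd_sgn_le:
  "2 * \<bar>a * b - odd_sgn a * odd_sgn b\<bar>
    \<le> (a * a - odd_sgn a * odd_sgn a) + (b * b - odd_sgn b * odd_sgn b)"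
proof -
  have sq: "(odd_sgn a + odd_sgn c)\<^sup>2 \<le> (a + c)\<^sup>2" for c
    using abs_odd_sgn_add_le[of a c] by (simp add: abs_le_square_iff)
  have "2 * (a * b - odd_sgn a * odd_sgn b)
      \<le> (a * a - odd_sgn a * odd_sgn a) + (b * b - odd_sgn b * odd_sgn b)"
    using sq[of "- b"] by (simp add: odd_sgn_minus power2_eq_square algebra_simps)
  moreover have "2 * - (a * b - odd_sgn a * odd_sgn b)
      \<le> (a * a - odd_sgn a * odd_sgn a) + (b * b - odd_sgn b * odd_sgn b)"
    using sq[of b] by (simp add: power2_eq_square algebra_simps)
  ultimately show ?thesis
    by (simp only: abs_if split: if_split) simp
qed

text \<open>
  Bounding each off-diagonal term by the mean of two diagonal entries of \<open>D\<close> charges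
  \<open>\<bar>Q $ i $ j\<bar> * D i i / 2\<close> to row \<open>i\<close> and \<open>\<bar>Q $ i $ j\<bar> * D j j / 2\<close> to row \<open>j\<close>. By
  symmetry row \<open>i\<close> is charged \<open>D i i\<close> times its off-diagonal sum in total, which is at most
  \<open>Q $ i $ i * D i i\<close>.
\<close>

lemma weighted_sum_nonneg_of_diagonally_dominant:
  fixes Q :: "real ^ 'n ^ 'n" and D :: "'n \<Rightarrow> 'n \<Rightarrow> real"
  assumes sym: "transpose Q = Q"
    and dom: "\<And>i. (\<Sum>j\<in>UNIV - {i}. \<bar>Q $ i $ j\<bar>) \<le> Q $ i $ i"
    and D: "\<And>i j. 2 * \<bar>D i j\<bar> \<le> D i i + D j j"
  shows "0 \<le> (\<Sum>i\<in>UNIV. \<Sum>j\<in>UNIV. Q $ i $ j * D i j)"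
proof -
  define A where "A i j = (if i = j then 0 else \<bar>Q $ i $ j\<bar>)" for i j
  have A_sym: "A i j = A j i" for i j
    using arg_cong[OF sym, of "\<lambda>M. M $ i $ j"] by (simp add: A_def transpose_def)
  have diag: "0 \<le> D i i" for i
    using D[of i i] by simp
  have row: "(\<Sum>j\<in>UNIV. A i j) \<le> Q $ i $ i" for i
    using dom[of i] by (simp add: A_def sum.remove[of UNIV i])
  have "(\<Sum>i\<in>UNIV. \<Sum>j\<in>UNIV. A i j * D j j) = (\<Sum>i\<in>UNIV. \<Sum>j\<in>UNIV. A i j * D i i)"
    by (subst sum.swap, subst A_sym) (rule refl)
  then have "(\<Sum>i\<in>UNIV. \<Sum>j\<in>UNIV. A i j * ((D i i + D j j) / 2))
      = (\<Sum>i\<in>UNIV. \<Sum>j\<in>UNIV. A i j * D i i)"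
    by (simp add: distrib_left add_divide_distrib sum.distrib flip: sum_divide_distrib)
  also have "\<dots> = (\<Sum>i\<in>UNIV. (\<Sum>j\<in>UNIV. A i j) * D i i)"
    by (simp add: sum_distrib_right)
  also have "\<dots> \<le> (\<Sum>i\<in>UNIV. Q $ i $ i * D i i)"
    by (intro sum_mono mult_right_mono row diag)
  finally have charge: "(\<Sum>i\<in>UNIV. \<Sum>j\<in>UNIV. A i j * ((D i i + D j j) / 2))
      \<le> (\<Sum>i\<in>UNIV. Q $ i $ i * D i i)" .
  have entry: "(if i = j then Q $ i $ i * D i i else 0) - A i j * ((D i i + D j j) / 2)
      \<le> Q $ i $ j * D i j" for i j
  proof (cases "i = j")
    case False
    have "\<bar>Q $ i $ j * D i j\<bar> \<le> \<bar>Q $ i $ j\<bar> * ((D i i + D j j) / 2)"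
      unfolding abs_mult using D[of i j] by (intro mult_left_mono) auto
    then show ?thesis
      using False by (simp add: A_def)
  qed (simp add: A_def)
  have "0 \<le> (\<Sum>i\<in>UNIV. \<Sum>j\<in>UNIV.
      (if i = j then Q $ i $ i * D i i else 0) - A i j * ((D i i + D j j) / 2))"
    using charge by (simp add: sum_subtractf)
  also have "\<dots> \<le> (\<Sum>i\<in>UNIV. \<Sum>j\<in>UNIV. Q $ i $ j * D i j)"
    by (intro sum_mono entry)
  finally show ?thesis .
qed

lemma quad_form_odd_sgn_vec_le:
  fixes Q :: "real ^ 'n ^ 'n"
  assumes "transpose Q = Q"
    and "\<And>i. (\<Sum>j\<in>UNIV - {i}. \<bar>Q $ i $ j\<bar>) \<le> Q $ i $ i"
  shows "quad_form Q (odd_sgn_vec d) \<le> quad_form Q d"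
proof -
  let ?e = "odd_sgn_vec d"
  have "0 \<le> (\<Sum>i\<in>UNIV. \<Sum>j\<in>UNIV. Q $ i $ j * real_of_int (d $ i * d $ j - ?e $ i * ?e $ j))"
  proof (rule weighted_sum_nonneg_of_diagonally_dominant[OF assms])
    fix i j
    have "2 * \<bar>d $ i * d $ j - ?e $ i * ?e $ j\<bar>
        \<le> (d $ i * d $ i - ?e $ i * ?e $ i) + (d $ j * d $ j - ?e $ j * ?e $ j)"
      using abs_mult_diff_odd_sgn_le[of "d $ i" "d $ j"] by (simp add: odd_sgn_vec_def)
    then show "2 * \<bar>real_of_int (d $ i * d $ j - ?e $ i * ?e $ j)\<bar>
        \<le> real_of_int (d $ i * d $ i - ?e $ i * ?e $ i)
          + real_of_int (d $ j * d $ j - ?e $ j * ?e $ j)"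
      by linarith
  qed
  also have "\<dots> = quad_form Q d - quad_form Q ?e"
    by (simp add: quad_form_eq_sum right_diff_distrib sum_subtractf)
  finally show ?thesis by simp
qed

text \<open>
  The difference of the two values is \<open>(d - e)\<^sup>T Q (d + e)\<close> with \<open>e = odd_sgn_vec d\<close>. The
  vector \<open>d\<close> is chosen so that \<open>d - e\<close> is supported at \<open>i\<close>, which isolates row \<open>i\<close> of \<open>Q\<close>.
\<close>

lemma diagonally_dominant_of_quad_form_odd_sgn_vec_le:
  fixes Q :: "real ^ 'n ^ 'n"
  assumes sym: "transpose Q = Q"
    and le: "\<And>d. quad_form Q (odd_sgn_vec d) \<le> quad_form Q d"
  shows "(\<Sum>j\<in>UNIV - {i}. \<bar>Q $ i $ j\<bar>) \<le> Q $ i $ i"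
proof -
  define d :: "int ^ 'n" where
    "d = (\<chi> j. if j = i then 2 else if Q $ i $ j \<ge> 0 then -1 else 1)"
  let ?e = "odd_sgn_vec d"
  have e: "real_vec d = real_vec ?e + axis i 2"
    by (simp add: vec_eq_iff real_vec_def odd_sgn_vec_def odd_sgn_def d_def axis_def)
  have "real_vec ?e \<bullet> (Q *v axis i 2) = axis i 2 \<bullet> (Q *v real_vec ?e)"
    using sym by (metis dot_lmul_matrix inner_commute vector_transpose_matrix)
  then have "quad_form Q d - quad_form Q ?e
      = 2 * (axis i 2 \<bullet> (Q *v real_vec ?e)) + axis i 2 \<bullet> (Q *v axis i 2)"
    unfolding quad_form_def e by (simp add: matrix_vector_right_distrib inner_add_left inner_add_right)
  also have "axis i 2 \<bullet> (Q *v axis i 2) = 4 * Q $ i $ i"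
    by (simp add: inner_axis' matrix_vector_mult_def) (simp add: axis_def if_distrib cong: if_cong)
  also have "axis i 2 \<bullet> (Q *v real_vec ?e) = 2 * (\<Sum>j\<in>UNIV. Q $ i $ j * real_of_int (?e $ j))"
    by (simp add: inner_axis' matrix_vector_mult_def real_vec_def)
  also have "(\<Sum>j\<in>UNIV. Q $ i $ j * real_of_int (?e $ j)) = - (\<Sum>j\<in>UNIV - {i}. \<bar>Q $ i $ j\<bar>)"
  proof -
    have "(\<Sum>j\<in>UNIV. Q $ i $ j * real_of_int (?e $ j))
        = (\<Sum>j\<in>UNIV - {i}. Q $ i $ j * real_of_int (?e $ j))"
      by (simp add: sum.remove[of UNIV i] odd_sgn_vec_def odd_sgn_def d_def)
    also have "\<dots> = (\<Sum>j\<in>UNIV - {i}. - \<bar>Q $ i $ j\<bar>)"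
      by (rule sum.cong) (auto simp: odd_sgn_vec_def odd_sgn_def d_def)
    finally show ?thesis by (simp add: sum_negf)
  qed
  finally show ?thesis
    using le[of d] by simp
qed

theorem theorem5p2:
  fixes Q :: "real ^ 'n ^ 'n"
  assumes "transpose Q = Q"
  shows "ddm_convex (\<lambda>x. ereal (quad_form Q x)) \<longleftrightarrow>
    (\<forall>i. Q $ i $ i \<ge> (\<Sum>j\<in>UNIV - {i}. \<bar>Q $ i $ j\<bar>))"
  unfolding ddm_convex_quad_form_iff
  using quad_form_odd_sgn_vec_le[OF assms]
    diagonally_dominant_of_quad_form_odd_sgn_vec_le[OF assms]
  by blast

end
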